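(* Let $(X,\mathfrak{M},\mu)$ be a measure space with a ball-basis $\mathscr{B}$ satisfying the doubling and regularity properties, let $\mathcal{K}$ be its hull-ball constant, $\theta$ its regularity constant and $\beta$ its growth constant (see context), let $0<\varepsilon<1$ and $$\alpha=1-\frac{\varepsilon\theta}{4\beta^2\mathcal{K}}>1/2 .$$ If $g\in\mathrm{BMO}_\alpha(X)$ (perhaps non-measurable), then $$\mu^*\{x\in B:\ |g(x)|>\lambda+\|g\|_{\mathrm{BMO}_\alpha}\}\le\varepsilon\cdot\mu^*\{x\in B:\ |g(x)|>\lambda\}$$ for any ball $B\in\mathscr{B}$ and any number $\lambda>0$, provided $$\mu^*\{x\in B:\ |g(x)|>\lambda\}\le\frac{\theta}{5\mathcal{K}\beta^2}\cdot\mu(B).$$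
   Context: **Ball-basis.** Let $(X,\mathfrak{M},\mu)$ be a measure space. A family $\mathscr{B}\subset\mathfrak{M}$ (its elements are called balls) is a ball-basis if: (B1) $0<\mu(B)<\infty$ for all $B\in\mathscr{B}$; (B2) for any $x,y\in X$ there is a ball containing both; (B3) for every $E\in\mathfrak{M}$ and $\varepsilon>0$ there is a finite or infinite sequence of balls $B_k$ with $\mu(E\bigtriangleup\bigcup_kB_k)<\varepsilon$; (B4) for each $B\in\mathscr{B}$ there is a ball $B^*\in\mathscr{B}$ (a hull-ball of $B$, fixed once and for all) such that $\bigcup\{A\in\mathscr{B}:\mu(A)\le2\mu(B),\,A\cap B\ne\varnothing\}\subset B^*$ and $\mu(B^* )\le\mathcal{K}\mu(B)$, with $\mathcal{K}>0$ independent of $B$. It is doubling if there is a constant $\eta>2$ such that for every ball $B$ with $B^*\ne X$ there is a ball $B'\supset B$ with $2\mu(B)\le\mu(B')\le\eta\mu(B)$. It is regular if there is a constant $0<\theta<1$ such that $\mu(B^*\cap A)\ge\theta\mu(B^* )$ for any balls $A,B$ with $\mu(B)\le\mu(A)$, $A\cap B\ne\varnothing$; this is the regularity constant $\theta$. **Growth constant.** $\beta>2$ denotes a constant, depending only on the doubling ball-basis, with the following property: for each $G\in\mathscr{B}$ there is a finite or infinite sequence of balls $G=G_1,G_2,\ldots$ such that $X=\bigcup_kG_k$, $G_k^*\subset G_{k+1}$, every ball is contained in some $G_n$, and $2\mu(G_k)\le\mu(G_{k+1})\le\beta\mu(G_k)$. **Notation.** $\mu^*(E)=\inf\{\mu(F):F\in\mathfrak{M},\,F\supset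 E\}$ is the outer measure. For a possibly non-measurable a.e. finite function $g$ and measurable $E$, $\mathrm{OSC}_E(g)=\operatorname{ess\,sup}_{x,x'\in E}|g(x)-g(x')|$ (up to subsets of null sets); $\mathrm{OSC}_{B,\alpha}(g)=\inf\{\mathrm{OSC}_E(g):E\subset B\text{ measurable},\,\mu(E)>\alpha\mu(B)\}$; $g\in\mathrm{BMO}_\alpha(X)$ means $\|g\|_{\mathrm{BMO}_\alpha}=\sup_{B\in\mathscr{B}}\mathrm{OSC}_{B,\alpha}(g)<\infty$. *)

theory Defs
  imports "HOL-Analysis.Analysis"
begin

(* The map hb is the fixed choice of hull-balls B \<mapsto> B^*.
   The finite or infinite sequence in the third condition is rendered as a countable family of
   balls, possibly empty: requiring a nonempty one would, for E = {}, force balls of arbitrarily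
   small measure and so exclude atomic spaces. *)
definition ball_basis :: "'a measure \<Rightarrow> 'a set set \<Rightarrow> ('a set \<Rightarrow> 'a set) \<Rightarrow> real \<Rightarrow> bool" where
  "ball_basis M \<B> hb K \<longleftrightarrow>
     \<B> \<subseteq> sets M \<and>
     (\<forall>B\<in>\<B>. 0 < emeasure M B \<and> emeasure M B < \<infinity>) \<and>
     (\<forall>x\<in>space M. \<forall>y\<in>space M. \<exists>B\<in>\<B>. x \<in> B \<and> y \<in> B) \<and>
     (\<forall>E\<in>sets M. \<forall>e::real. 0 < e \<longrightarrow>
        (\<exists>C\<subseteq>\<B>. countable C \<and> emeasure M (sym_diff E (\<Union>C)) < ennreal e)) \<and>
     0 < K \<and>
     (\<forall>B\<in>\<B>. hb B \<in> \<B> \<and>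
        \<Union>{A \<in> \<B>. emeasure M A \<le> 2 * emeasure M B \<and> A \<inter> B \<noteq> {}} \<subseteq> hb B \<and>
        emeasure M (hb B) \<le> ennreal K * emeasure M B)"

definition doubling :: "'a measure \<Rightarrow> 'a set set \<Rightarrow> ('a set \<Rightarrow> 'a set) \<Rightarrow> bool" where
  "doubling M \<B> hb \<longleftrightarrow>
     (\<exists>\<eta>::real. \<eta> > 2 \<and>
        (\<forall>B\<in>\<B>. hb B \<noteq> space M \<longrightarrow>
           (\<exists>B'\<in>\<B>. B \<subseteq> B' \<and> 2 * emeasure M B \<le> emeasure M B' \<and>
                    emeasure M B' \<le> ennreal \<eta> * emeasure M B)))"

definition regularity_constant ::
    "'a measure \<Rightarrow> 'a set set \<Rightarrow> ('a set \<Rightarrow> 'a set) \<Rightarrow> real \<Rightarrow> bool" where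
  "regularity_constant M \<B> hb \<theta> \<longleftrightarrow>
     0 < \<theta> \<and> \<theta> < 1 \<and>
     (\<forall>A\<in>\<B>. \<forall>B\<in>\<B>. emeasure M B \<le> emeasure M A \<and> A \<inter> B \<noteq> {} \<longrightarrow>
        ennreal \<theta> * emeasure M (hb B) \<le> emeasure M (hb B \<inter> A))"

(* The sequence is G 0, G 1, ... with index set {k. enat k < N}; N = \<infinity> is the infinite case. *)
definition growth_constant ::
    "'a measure \<Rightarrow> 'a set set \<Rightarrow> ('a set \<Rightarrow> 'a set) \<Rightarrow> real \<Rightarrow> bool" where
  "growth_constant M \<B> hb \<beta> \<longleftrightarrow>
     \<beta> > 2 \<and>
     (\<forall>B\<in>\<B>. \<exists>(N::enat) (G::nat \<Rightarrow> 'a set).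
        0 < N \<and> G 0 = B \<and>
        (\<forall>k. enat k < N \<longrightarrow> G k \<in> \<B>) \<and>
        space M = (\<Union>k\<in>{k. enat k < N}. G k) \<and>
        (\<forall>k. enat (Suc k) < N \<longrightarrow>
           hb (G k) \<subseteq> G (Suc k) \<and>
           2 * emeasure M (G k) \<le> emeasure M (G (Suc k)) \<and>
           emeasure M (G (Suc k)) \<le> ennreal \<beta> * emeasure M (G k)) \<and>
        (\<forall>A\<in>\<B>. \<exists>k. enat k < N \<and> A \<subseteq> G k))"

(* The essential supremum of |g x - g x'| over x, x' in E, for g not necessarily measurable
   and only a.e. finite: the least bound that holds on E outside a null set. At points where g
   is infinite the difference is never bounded by a real number (\<infinity> - \<infinity> = \<infinity> in ereal). *)
definition OSC :: "'a measure \<Rightarrow> ('a \<Rightarrow> ereal) \<Rightarrow> 'a set \<Rightarrow> ereal" where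
  "OSC M g E =
     Inf {c. 0 \<le> c \<and> (\<exists>N\<in>null_sets M. \<forall>x\<in>E - N. \<forall>x'\<in>E - N. \<bar>g x - g x'\<bar> \<le> c)}"

definition OSC_ball :: "'a measure \<Rightarrow> real \<Rightarrow> ('a \<Rightarrow> ereal) \<Rightarrow> 'a set \<Rightarrow> ereal" where
  "OSC_ball M \<alpha> g B =
     (INF E\<in>{E\<in>sets M. E \<subseteq> B \<and> ennreal \<alpha> * emeasure M B < emeasure M E}. OSC M g E)"

definition BMO_norm :: "'a measure \<Rightarrow> 'a set set \<Rightarrow> real \<Rightarrow> ('a \<Rightarrow> ereal) \<Rightarrow> ereal" where
  "BMO_norm M \<B> \<alpha> g = (SUP B\<in>\<B>. OSC_ball M \<alpha> g B)"

definition BMO :: "'a measure \<Rightarrow> 'a set set \<Rightarrow> real \<Rightarrow> ('a \<Rightarrow> ereal) set" where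
  "BMO M \<B> \<alpha> = {g. (AE x in M. \<bar>g x\<bar> \<noteq> \<infinity>) \<and> BMO_norm M \<B> \<alpha> g < \<infinity>}"

end

theory Submission
  imports Defs
begin

text \<open>
  Let \<open>E\<close> be the part of \<open>B\<close> where \<open>\<bar>g\<bar> > l\<close> and \<open>H \<subseteq> B\<close> a measurable hull of \<open>E\<close>. The idea is a
  Calderon--Zygmund decomposition of \<open>H\<close> at height \<open>c = \<theta> / (4 * \<beta>)\<close>. Almost every point of \<open>E\<close>
  lies in a ball in which \<open>H\<close> has density greater than \<open>c\<close>; otherwise the exceptional points,
  approximated by a union of balls, would fill at most half of each of those balls, which a Vitali
  covering argument forbids (\<open>sparse_points_null\<close>). Start the growth sequence at such a ball and
  take its last member \<open>A\<close> of density greater than \<open>c\<close>. The smallness of \<open>\<mu>(E)\<close> forces \<open>A\<close> to be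
  so much smaller than \<open>B\<close> that two further members exist, and the first of these has a hull
  \<open>Q\<close> containing the hull of \<open>A\<close>, of measure at most \<open>K * \<beta> * \<mu>(A)\<close>, in which \<open>H\<close> has density at
  most \<open>\<theta> / 4\<close> (\<open>growth_stopping\<close>).

  Regularity says that \<open>B\<close> fills the proportion \<open>\<theta>\<close> of \<open>Q\<close>, hence \<open>\<bar>g\<bar> \<le> l\<close> on a proportion
  \<open>3 * \<theta> / 4\<close> of \<open>Q\<close>. The BMO condition provides a subset of \<open>Q\<close> of proportion greater than
  \<open>\<alpha>\<close> on which \<open>g\<close> oscillates essentially by no more than the norm, up to an arbitrarily small
  \<open>\<delta>\<close>. The two sets overlap, so outside an exceptional set of measure \<open>(1 - \<alpha>) * \<mu>(Q)\<close> one has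
  \<open>\<bar>g\<bar> \<le> l + \<parallel>g\<parallel> + \<delta>\<close> on \<open>Q\<close> (\<open>exceptional_set_small\<close>).

  Finally, the Vitali selection picks disjoint balls \<open>A\<^sub>j\<close> among the \<open>A\<close> such that their hulls,
  and so the sets \<open>Q\<^sub>j\<close>, cover \<open>E\<close> up to a null set. The constants match exactly:
  \<open>(1 - \<alpha>) * \<mu>(Q\<^sub>j) \<le> (1 - \<alpha>) * K * \<beta> / c * \<mu>(A\<^sub>j \<inter> H) = \<epsilon> * \<mu>(A\<^sub>j \<inter> H)\<close>,
  and disjointness sums this to \<open>\<epsilon> * \<mu>(H)\<close>. The slack \<open>\<delta>\<close> disappears because outer measure
  is continuous along increasing sequences of arbitrary sets.
\<close>

section \<open>Balls and their hulls\<close>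

text \<open>All sets that matter have finite measure, so the axioms are used in their real-valued form.\<close>

locale ball_basis_space =
  fixes M :: "'a measure" and \<B> :: "'a set set" and hb :: "'a set \<Rightarrow> 'a set" and K :: real
  assumes ball_basis: "ball_basis M \<B> hb K"
begin

lemma ball_fmeasurable: "A \<in> \<B> \<Longrightarrow> A \<in> fmeasurable M"
  using ball_basis by (auto simp: ball_basis_def fmeasurable_def)

lemma ball_emeasure: "A \<in> \<B> \<Longrightarrow> emeasure M A = ennreal (measure M A)"
  by (simp add: ball_fmeasurable emeasure_eq_measure2)

lemma ball_pos: "A \<in> \<B> \<Longrightarrow> 0 < measure M A"
  using ball_basis ball_emeasure[of A] by (auto simp: ball_basis_def)

lemma ball_nonempty: "A \<in> \<B> \<Longrightarrow> A \<noteq> {}"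
  using ball_pos by fastforce

lemma K_pos: "0 < K"
  using ball_basis by (simp add: ball_basis_def)

lemma hull_axiom:
  "\<forall>B\<in>\<B>. hb B \<in> \<B> \<and>
     \<Union>{A \<in> \<B>. emeasure M A \<le> 2 * emeasure M B \<and> A \<inter> B \<noteq> {}} \<subseteq> hb B \<and>
     emeasure M (hb B) \<le> ennreal K * emeasure M B"
  using ball_basis unfolding ball_basis_def by (elim conjE)

lemma hull_ball: "A \<in> \<B> \<Longrightarrow> hb A \<in> \<B>"
  using hull_axiom by simp

lemma hull_absorbs:
  assumes "A \<in> \<B>" "C \<in> \<B>" "measure M A \<le> 2 * measure M C" "A \<inter> C \<noteq> {}"
  shows "A \<subseteq> hb C"
proof -
  have "2 * emeasure M C = ennreal (2 * measure M C)"
    using assms by (simp add: ball_emeasure ennreal_mult'')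
  then have "emeasure M A \<le> 2 * emeasure M C"
    using assms by (simp add: ball_emeasure)
  moreover have "\<Union>{A \<in> \<B>. emeasure M A \<le> 2 * emeasure M C \<and> A \<inter> C \<noteq> {}} \<subseteq> hb C"
    using bspec[OF hull_axiom assms(2)] by (elim conjE)
  ultimately show ?thesis
    using assms by blast
qed

lemma ball_subset_hull: "A \<in> \<B> \<Longrightarrow> A \<subseteq> hb A"
  using hull_absorbs[of A A] ball_nonempty[of A] by simp

lemma hull_measure:
  assumes "A \<in> \<B>"
  shows "measure M (hb A) \<le> K * measure M A"
proof -
  have "emeasure M (hb A) \<le> ennreal K * emeasure M A"
    using bspec[OF hull_axiom assms] by (elim conjE)
  then show ?thesis
    using assms K_pos by (simp add: ball_emeasure hull_ball flip: ennreal_mult)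
qed

lemma K_ge_1:
  assumes "A \<in> \<B>"
  shows "1 \<le> K"
proof -
  have "measure M A \<le> K * measure M A"
    using measure_mono_fmeasurable[OF ball_subset_hull[OF assms], of M] hull_measure[OF assms]
      ball_fmeasurable[OF assms] ball_fmeasurable[OF hull_ball[OF assms]]
    by (simp add: fmeasurableD)
  then show ?thesis
    using ball_pos[OF assms] by simp
qed

lemma approximation_by_balls:
  assumes "E \<in> sets M" "0 < e"
  obtains \<C> where "\<C> \<subseteq> \<B>" "countable \<C>" "sym_diff E (\<Union>\<C>) \<in> fmeasurable M"
    "measure M (sym_diff E (\<Union>\<C>)) < e"
proof -
  have "\<forall>E\<in>sets M. \<forall>e::real. 0 < e \<longrightarrow>
      (\<exists>\<C>\<subseteq>\<B>. countable \<C> \<and> emeasure M (sym_diff E (\<Union>\<C>)) < ennreal e)"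
    using ball_basis unfolding ball_basis_def by (elim conjE)
  with assms obtain \<C> where C: "\<C> \<subseteq> \<B>" "countable \<C>"
    "emeasure M (sym_diff E (\<Union>\<C>)) < ennreal e"
    by meson
  have "\<Union>\<C> \<in> sets M"
    using C ball_fmeasurable by (intro sets.countable_Union) auto
  then have fm: "sym_diff E (\<Union>\<C>) \<in> fmeasurable M"
    using C(3) assms(1) less_trans[OF C(3) ennreal_less_top] by (intro fmeasurableI) auto
  then have "measure M (sym_diff E (\<Union>\<C>)) < e"
    using C by (simp add: emeasure_eq_measure2 ennreal_less_iff)
  with that C fm show ?thesis
    by blast
qed

end

section \<open>Vitali covering\<close>

lemma disjoint_sum_measure_Int_le:
  assumes "finite \<F>" "\<F> \<subseteq> sets M" "disjoint \<F>" "W \<in> fmeasurable M"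
  shows "(\<Sum>A\<in>\<F>. measure M (A \<inter> W)) \<le> measure M W"
proof -
  have fm: "A \<inter> W \<in> fmeasurable M" if "A \<in> \<F>" for A
    using that assms by (metis Int_commute fmeasurable_Int_fmeasurable subset_iff)
  have "(\<Sum>A\<in>\<F>. measure M (A \<inter> W)) = measure M (\<Union>A\<in>\<F>. A \<inter> W)"
    using assms fm
    by (intro measure_UNION'[symmetric]) (auto simp: pairwise_def disjnt_def)
  also have "\<dots> \<le> measure M W"
    using assms fm by (intro measure_mono_fmeasurable sets.finite_UN) auto
  finally show ?thesis .
qed

lemma measure_UN_le_disjoint:
  assumes "countable \<C>" "\<C> \<subseteq> sets M" "disjoint \<C>" "W \<in> fmeasurable M" "0 \<le> k"
    and T: "\<And>A. A \<in> \<C> \<Longrightarrow> T A \<in> fmeasurable M"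
    and le: "\<And>A. A \<in> \<C> \<Longrightarrow> measure M (T A) \<le> k * measure M (A \<inter> W)"
  shows "(\<Union>A\<in>\<C>. T A) \<in> fmeasurable M" "measure M (\<Union>A\<in>\<C>. T A) \<le> k * measure M W"
proof -
  have bound: "measure M (\<Union>A\<in>\<F>. T A) \<le> k * measure M W" if F: "\<F> \<subseteq> \<C>" "finite \<F>" for \<F>
  proof -
    have "measure M (\<Union>A\<in>\<F>. T A) \<le> (\<Sum>A\<in>\<F>. measure M (T A))"
      using F T by (intro measure_UNION_le) auto
    also have "\<dots> \<le> (\<Sum>A\<in>\<F>. k * measure M (A \<inter> W))"
      using F le by (intro sum_mono) auto
    also have "\<dots> \<le> k * measure M W"
      unfolding sum_distrib_left[symmetric]
      using F assms by (intro mult_left_mono disjoint_sum_measure_Int_le)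
        (auto intro: pairwise_subset)
    finally show ?thesis .
  qed
  show "(\<Union>A\<in>\<C>. T A) \<in> fmeasurable M" "measure M (\<Union>A\<in>\<C>. T A) \<le> k * measure M W"
    by (rule fmeasurable_UN_bound[OF assms(1) T bound]; assumption)
      (rule measure_UN_bound[OF assms(1) T bound]; assumption)
qed

context ball_basis_space
begin

text \<open>
  The hypothesis on \<open>W\<close> bounds the measures of the balls and makes disjoint subfamilies countable.
  Instead of selecting greedily, Zorn's lemma is applied to the disjoint subfamilies that are good
  in the following sense: any ball that meets a selected ball meets one of at least half its size.
  If a maximal such family missed a ball completely, a nearly largest missed ball could be added.
\<close>

lemma vitali_selection:
  assumes sub: "\<A> \<subseteq> \<B>" and W: "W \<in> fmeasurable M"
    and dense: "\<And>A. A \<in> \<A> \<Longrightarrow> measure M A \<le> k * measure M (A \<inter> W)"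
  obtains \<C> where "\<C> \<subseteq> \<A>" "countable \<C>" "disjoint \<C>" "\<Union>\<A> \<subseteq> (\<Union>C\<in>\<C>. hb C)"
proof -
  have pos: "0 < measure M A" and fm: "A \<in> fmeasurable M" if "A \<in> \<A>" for A
    using that sub ball_pos ball_fmeasurable by auto
  define good where "good \<C> \<longleftrightarrow> \<C> \<subseteq> \<A> \<and> disjoint \<C> \<and>
    (\<forall>A\<in>\<A>. (\<exists>C\<in>\<C>. A \<inter> C \<noteq> {}) \<longrightarrow>
      (\<exists>C\<in>\<C>. A \<inter> C \<noteq> {} \<and> measure M A \<le> 2 * measure M C))" for \<C>
  have "\<exists>\<C>\<in>Collect good. \<forall>\<D>\<in>Collect good. \<C> \<subseteq> \<D> \<longrightarrow> \<D> = \<C>"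
  proof (rule subset_Zorn')
    fix \<Z> assume chain: "subset.chain (Collect good) \<Z>"
    have g: "good \<C>" if "\<C> \<in> \<Z>" for \<C>
      using that chain by (auto simp: subset.chain_def)
    have "disjoint (\<Union>\<Z>)"
    proof (rule pairwiseI)
      fix C D assume *: "C \<in> \<Union>\<Z>" "D \<in> \<Union>\<Z>" "C \<noteq> D"
      then obtain \<C> \<D> where "\<C> \<in> \<Z>" "\<D> \<in> \<Z>" "C \<in> \<C>" "D \<in> \<D>"
        by blast
      moreover from this chain have "\<C> \<subseteq> \<D> \<or> \<D> \<subseteq> \<C>"
        by (auto simp: subset_chain_def)
      ultimately have "\<exists>\<C>\<in>\<Z>. C \<in> \<C> \<and> D \<in> \<C>"
        by blast
      with * g show "disjnt C D"
        unfolding good_def pairwise_def by blast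
    qed
    moreover have "\<Union>\<Z> \<subseteq> \<A>"
      using g by (auto simp: good_def)
    moreover have "\<exists>C\<in>\<Union>\<Z>. A \<inter> C \<noteq> {} \<and> measure M A \<le> 2 * measure M C"
      if "A \<in> \<A>" and ex: "\<exists>C\<in>\<Union>\<Z>. A \<inter> C \<noteq> {}" for A
    proof -
      obtain \<C> where "\<C> \<in> \<Z>" "\<exists>C\<in>\<C>. A \<inter> C \<noteq> {}"
        using ex by blast
      with g[of \<C>] \<open>A \<in> \<A>\<close> have "\<exists>C\<in>\<C>. A \<inter> C \<noteq> {} \<and> measure M A \<le> 2 * measure M C"
        unfolding good_def by blast
      with \<open>\<C> \<in> \<Z>\<close> show ?thesis
        by blast
    qed
    ultimately show "\<Union>\<Z> \<in> Collect good"
      by (simp add: good_def)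
  qed
  then obtain \<C> where C: "good \<C>" and max: "\<And>\<D>. good \<D> \<Longrightarrow> \<C> \<subseteq> \<D> \<Longrightarrow> \<D> = \<C>"
    by blast
  have meets: "\<exists>C\<in>\<C>. A \<inter> C \<noteq> {}" if A: "A \<in> \<A>" for A
  proof (rule ccontr)
    assume no: "\<not> ?thesis"
    \<comment> \<open>The balls that could still be added; a ball within a factor 2 of their supremum is added.\<close>
    define \<R> where "\<R> = {A\<in>\<A>. \<forall>C\<in>\<C>. A \<inter> C = {}}"
    have "A \<in> \<R>"
      using A no by (auto simp: \<R>_def)
    define s where "s = (SUP A\<in>\<R>. measure M A)"
    have bound: "measure M A \<le> k * measure M W" if "A \<in> \<R>" for A
    proof -
      have "A \<in> \<A>"
        using that by (simp add: \<R>_def)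
      have "0 < k * measure M (A \<inter> W)"
        using dense pos \<open>A \<in> \<A>\<close> by (meson less_le_trans)
      then have "0 \<le> k"
        by (metis less_eq_real_def measure_nonneg not_le zero_less_mult_iff)
      moreover have "measure M (A \<inter> W) \<le> measure M W"
        using W fm \<open>A \<in> \<A>\<close> by (intro measure_mono_fmeasurable) auto
      ultimately show ?thesis
        using dense[OF \<open>A \<in> \<A>\<close>] by (meson mult_left_mono order_trans)
    qed
    have bdd: "bdd_above (measure M ` \<R>)"
      using bound by (rule bdd_aboveI2)
    have "measure M A \<le> s"
      unfolding s_def using bdd \<open>A \<in> \<R>\<close> by (intro cSUP_upper)
    then have "s / 2 < s"
      using pos[OF A] by simp
    then obtain D where D: "D \<in> \<R>" "s / 2 < measure M D"
      unfolding s_def using less_cSUP_iff[OF _ bdd] \<open>A \<in> \<R>\<close> by blast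
    have half: "measure M A' \<le> 2 * measure M D" if "A' \<in> \<R>" for A'
    proof -
      have "measure M A' \<le> s"
        unfolding s_def using bdd that by (intro cSUP_upper)
      with D show ?thesis
        by simp
    qed
    have "good (insert D \<C>)"
      unfolding good_def
    proof (intro conjI ballI impI)
      show "insert D \<C> \<subseteq> \<A>"
        using C D by (auto simp: good_def \<R>_def)
      show "disjoint (insert D \<C>)"
        using C D unfolding good_def \<R>_def
        by (auto simp: pairwise_insert disjnt_def)
      fix A' assume A': "A' \<in> \<A>" "\<exists>C\<in>insert D \<C>. A' \<inter> C \<noteq> {}"
      show "\<exists>C\<in>insert D \<C>. A' \<inter> C \<noteq> {} \<and> measure M A' \<le> 2 * measure M C"
      proof (cases "A' \<in> \<R>")
        case True
        with A' half show ?thesis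
          by (auto simp: \<R>_def)
      next
        case False
        with A' C show ?thesis
          unfolding good_def \<R>_def by blast
      qed
    qed
    then have "D \<in> \<C>"
      using max by blast
    with D have "D \<inter> D = {}" "D \<in> \<A>"
      by (auto simp: \<R>_def)
    with sub ball_nonempty show False
      by auto
  qed
  have "\<Union>\<A> \<subseteq> (\<Union>C\<in>\<C>. hb C)"
  proof
    fix x assume "x \<in> \<Union>\<A>"
    then obtain A where A: "A \<in> \<A>" "x \<in> A"
      by blast
    have "\<exists>D\<in>\<C>. A \<inter> D \<noteq> {} \<and> measure M A \<le> 2 * measure M D"
      using C A(1) meets[OF A(1)] by (simp add: good_def)
    then obtain D where D: "D \<in> \<C>" "A \<inter> D \<noteq> {}" "measure M A \<le> 2 * measure M D"
      by blast
    have "A \<in> \<B>" "D \<in> \<B>"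
      using A D C sub by (auto simp: good_def)
    then have "A \<subseteq> hb D"
      using D hull_absorbs by simp
    with A D show "x \<in> (\<Union>C\<in>\<C>. hb C)"
      by blast
  qed
  moreover have "countable \<C>"
  proof -
    have CA: "\<C> \<subseteq> \<A>" "disjoint \<C>"
      using C by (auto simp: good_def)
    have "(\<lambda>A. measure M (A \<inter> W)) summable_on \<C>"
    proof (rule nonneg_bdd_above_summable_on)
      show "bdd_above (sum (\<lambda>A. measure M (A \<inter> W)) ` {F. F \<subseteq> \<C> \<and> finite F})"
        using CA W fm by (intro bdd_aboveI[of _ "measure M W"])
          (auto intro!: disjoint_sum_measure_Int_le intro: pairwise_subset)
    qed simp
    then have "countable {A\<in>\<C>. measure M (A \<inter> W) \<noteq> 0}"
      by (rule summable_countable_real)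
    moreover have "{A\<in>\<C>. measure M (A \<inter> W) \<noteq> 0} = \<C>"
      using CA dense pos by fastforce
    ultimately show ?thesis
      by simp
  qed
  ultimately show ?thesis
    using that C by (auto simp: good_def)
qed

section \<open>Density and stopping\<close>

text \<open>
  A weak form of the Lebesgue density theorem. Cover a measurable hull \<open>H\<close> of \<open>D\<close> by balls with
  excess \<open>W\<close> of measure less than \<open>\<delta>\<close>. Every ball that meets \<open>D\<close> has at least half of its mass in \<open>W\<close>, so
  the hulls of a Vitali subfamily have total measure at most \<open>2 * K * \<delta>\<close>, and yet they cover
  \<open>D\<close> up to measure \<open>\<delta>\<close>.
\<close>

lemma sparse_points_null:
  assumes E: "E \<in> fmeasurable M" and "D \<subseteq> E"
    and sparse: "\<And>A. A \<in> \<B> \<Longrightarrow> A \<inter> D \<noteq> {} \<Longrightarrow> 2 * measure M (A \<inter> E) \<le> measure M A"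
  obtains N where "N \<in> null_sets M" "D \<subseteq> N"
proof -
  have "D \<subseteq> space M"
    using \<open>D \<subseteq> E\<close> sets.sets_into_space[OF fmeasurableD[OF E]] by blast
  then obtain H0 where H0: "H0 \<in> sets M" "D \<subseteq> H0" "outer_measure_of M D = emeasure M H0"
    by (auto dest: outer_measure_of_attain)
  define H where "H = H0 \<inter> E"
  have H: "H \<in> fmeasurable M" "D \<subseteq> H" "H \<subseteq> E"
    using H0 assms by (auto simp: H_def intro: fmeasurableI2[OF E])
  \<comment> \<open>A hull of \<open>D\<close> is bounded in measure by every cover, in particular by the one built from hulls.\<close>
  have minimal: "measure M H \<le> measure M F" if "F \<in> fmeasurable M" "D \<subseteq> F" for F
  proof -
    have "emeasure M H \<le> emeasure M H0"
      using H0 by (intro emeasure_mono) (auto simp: H_def)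
    also have "\<dots> \<le> emeasure M F"
      using outer_measure_of_mono[OF that(2), of M] H0 that by simp
    finally show ?thesis
      using that H by (simp add: emeasure_eq_measure2)
  qed
  have small: "measure M H \<le> (1 + 2 * K) * \<delta>" if "0 < \<delta>" for \<delta>
  proof -
    obtain \<C> where C: "\<C> \<subseteq> \<B>" "countable \<C>" "sym_diff H (\<Union>\<C>) \<in> fmeasurable M"
      "measure M (sym_diff H (\<Union>\<C>)) < \<delta>"
      using approximation_by_balls[OF fmeasurableD[OF H(1)] \<open>0 < \<delta>\<close>] .
    have UC: "\<Union>\<C> \<in> sets M"
      using C ball_fmeasurable by (intro sets.countable_Union) auto
    define W where "W = \<Union>\<C> - H"
    have W: "W \<in> fmeasurable M" "H - \<Union>\<C> \<in> fmeasurable M"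
      using C UC H by (auto simp: W_def intro!: fmeasurableI2[OF C(3)])
    have W_le: "measure M W \<le> \<delta>" "measure M (H - \<Union>\<C>) \<le> \<delta>"
    proof -
      have "measure M W \<le> measure M (sym_diff H (\<Union>\<C>))"
        using W C by (intro measure_mono_fmeasurable) (auto simp: W_def)
      with C show "measure M W \<le> \<delta>"
        by simp
      have "measure M (H - \<Union>\<C>) \<le> measure M (sym_diff H (\<Union>\<C>))"
        using W C by (intro measure_mono_fmeasurable) auto
      with C show "measure M (H - \<Union>\<C>) \<le> \<delta>"
        by simp
    qed
    define \<A> where "\<A> = {A\<in>\<C>. A \<inter> D \<noteq> {}}"
    have AB: "\<A> \<subseteq> \<B>"
      using C by (auto simp: \<A>_def)
    have dense: "measure M A \<le> 2 * measure M (A \<inter> W)" if "A \<in> \<A>" for A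
    proof -
      have A: "A \<in> \<B>" "A \<in> fmeasurable M"
        using that AB ball_fmeasurable by auto
      have "A = (A \<inter> H) \<union> (A \<inter> W)"
        using that by (auto simp: W_def \<A>_def)
      then have "measure M A \<le> measure M (A \<inter> H) + measure M (A \<inter> W)"
        using measure_Un_le[of "A \<inter> H" M "A \<inter> W"] A H W by auto
      moreover have "measure M (A \<inter> H) \<le> measure M (A \<inter> E)"
        using A H E by (intro measure_mono_fmeasurable) (auto intro: fmeasurable_Int_fmeasurable)
      moreover have "2 * measure M (A \<inter> E) \<le> measure M A"
        using sparse A that by (simp add: \<A>_def)
      ultimately show ?thesis
        by simp
    qed
    obtain \<V> where V: "\<V> \<subseteq> \<A>" "countable \<V>" "disjoint \<V>" "\<Union>\<A> \<subseteq> (\<Union>C\<in>\<V>. hb C)"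
      using vitali_selection[OF AB W(1) dense] .
    have VB: "\<V> \<subseteq> \<B>"
      using V AB by blast
    have hull_le: "measure M (hb A) \<le> (2 * K) * measure M (A \<inter> W)" if "A \<in> \<V>" for A
    proof -
      have "measure M (hb A) \<le> K * measure M A"
        using that VB hull_measure by auto
      also have "\<dots> \<le> K * (2 * measure M (A \<inter> W))"
        using that V dense K_pos by (intro mult_left_mono) auto
      finally show ?thesis
        by simp
    qed
    have hulls: "(\<Union>A\<in>\<V>. hb A) \<in> fmeasurable M"
      "measure M (\<Union>A\<in>\<V>. hb A) \<le> (2 * K) * measure M W"
      using measure_UN_le_disjoint[OF V(2) _ V(3) W(1), of "2 * K" hb] hull_le K_pos VB
        ball_fmeasurable hull_ball by auto
    have "measure M H \<le> measure M ((H - \<Union>\<C>) \<union> (\<Union>A\<in>\<V>. hb A))"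
    proof (rule minimal)
      show "D \<subseteq> (H - \<Union>\<C>) \<union> (\<Union>A\<in>\<V>. hb A)"
        using V(4) H(2) by (fastforce simp: \<A>_def)
    qed (use W hulls in auto)
    also have "\<dots> \<le> measure M (H - \<Union>\<C>) + measure M (\<Union>A\<in>\<V>. hb A)"
      using W hulls by (intro measure_Un_le) auto
    also have "\<dots> \<le> \<delta> + (2 * K) * \<delta>"
      using W_le hulls(2) K_pos by (meson add_mono mult_left_mono order_trans
          less_imp_le mult_nonneg_nonneg zero_le_numeral)
    finally show ?thesis
      by (simp add: algebra_simps)
  qed
  have "measure M H \<le> 0"
  proof (rule field_le_epsilon)
    fix e :: real assume "0 < e"
    then have "measure M H \<le> (1 + 2 * K) * (e / (1 + 2 * K))"
      using K_pos by (intro small) auto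
    then show "measure M H \<le> 0 + e"
      using K_pos by simp
  qed
  then have "H \<in> null_sets M"
    using H by (auto simp: null_sets_def emeasure_eq_measure2 intro: antisym)
  with that H show ?thesis
    by blast
qed

text \<open>
  With \<open>A = G k\<close> the last ball of the growth sequence in which \<open>H\<close> has density greater than
  \<open>\<theta> / (4 * \<beta>)\<close>, take \<open>P = G (k + 1)\<close>. Its hull lies in \<open>G (k + 2)\<close>, which is larger than \<open>P\<close> by a factor
  of at most \<open>\<beta>\<close>; this turns the low density of \<open>H\<close> in \<open>G (k + 2)\<close> into density at most \<open>\<theta> / 4\<close>
  in the hull of \<open>P\<close>.
\<close>

lemma growth_stopping:
  assumes growth: "growth_constant M \<B> hb \<beta>" and \<theta>: "0 < \<theta>"
    and B: "B \<in> \<B>" "x \<in> B"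
    and H: "H \<in> fmeasurable M" "measure M H \<le> \<theta> / (5 * K * \<beta>\<^sup>2) * measure M B"
    and A0: "A0 \<in> \<B>" "x \<in> A0" "\<theta> / (4 * \<beta>) * measure M A0 < measure M (A0 \<inter> H)"
  obtains A P where "A \<in> \<B>" "P \<in> \<B>" "x \<in> A" "x \<in> P"
    "\<theta> / (4 * \<beta>) * measure M A \<le> measure M (A \<inter> H)"
    "hb A \<subseteq> hb P" "measure M (hb P) \<le> K * \<beta> * measure M A" "measure M P \<le> measure M B"
    "measure M (hb P \<inter> H) \<le> \<theta> / 4 * measure M (hb P)"
proof -
  have \<beta>: "2 < \<beta>"
    using growth by (simp add: growth_constant_def)
  have K: "1 \<le> K"
    using K_ge_1 B by blast
  define c where "c = \<theta> / (4 * \<beta>)"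
  have c: "0 < c"
    using \<theta> \<beta> by (simp add: c_def)
  have "\<exists>(N::enat) (G::nat \<Rightarrow> 'a set).
        0 < N \<and> G 0 = A0 \<and>
        (\<forall>k. enat k < N \<longrightarrow> G k \<in> \<B>) \<and>
        space M = (\<Union>k\<in>{k. enat k < N}. G k) \<and>
        (\<forall>k. enat (Suc k) < N \<longrightarrow>
           hb (G k) \<subseteq> G (Suc k) \<and>
           2 * emeasure M (G k) \<le> emeasure M (G (Suc k)) \<and>
           emeasure M (G (Suc k)) \<le> ennreal \<beta> * emeasure M (G k)) \<and>
        (\<forall>A\<in>\<B>. \<exists>k. enat k < N \<and> A \<subseteq> G k)"
    by (rule bspec[OF conjunct2[OF growth[unfolded growth_constant_def]] A0(1)])
  then obtain N G where N: "0 < N" and G0: "G 0 = A0"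
    and ball: "\<forall>k. enat k < N \<longrightarrow> G k \<in> \<B>"
    and step: "\<forall>k. enat (Suc k) < N \<longrightarrow> hb (G k) \<subseteq> G (Suc k) \<and>
           2 * emeasure M (G k) \<le> emeasure M (G (Suc k)) \<and>
           emeasure M (G (Suc k)) \<le> ennreal \<beta> * emeasure M (G k)"
    and exhaust: "\<forall>A\<in>\<B>. \<exists>k. enat k < N \<and> A \<subseteq> G k"
    by (elim exE conjE) (rule that)
  have less_Suc: "enat k < N" if "enat (Suc k) < N" for k
    using that by (metis enat_ord_simps(2) lessI order_less_trans)
  have hullG: "hb (G k) \<subseteq> G (Suc k)"
    and G2: "2 * measure M (G k) \<le> measure M (G (Suc k))"
    and G\<beta>: "measure M (G (Suc k)) \<le> \<beta> * measure M (G k)" if "enat (Suc k) < N" for k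
  proof -
    have b: "G k \<in> \<B>" "G (Suc k) \<in> \<B>"
      using that less_Suc ball by auto
    have s: "2 * emeasure M (G k) \<le> emeasure M (G (Suc k))"
      "emeasure M (G (Suc k)) \<le> ennreal \<beta> * emeasure M (G k)"
      using step that by blast+
    have "ennreal (2 * measure M (G k)) \<le> ennreal (measure M (G (Suc k)))"
      using s(1) b by (simp add: ball_emeasure ennreal_mult'')
    then show "2 * measure M (G k) \<le> measure M (G (Suc k))"
      by (subst (asm) ennreal_le_iff) auto
    have "ennreal (measure M (G (Suc k))) \<le> ennreal (\<beta> * measure M (G k))"
      using s(2) b by (simp add: ball_emeasure ennreal_mult'')
    then show "measure M (G (Suc k)) \<le> \<beta> * measure M (G k)"
      using \<beta> by (subst (asm) ennreal_le_iff) auto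
    show "hb (G k) \<subseteq> G (Suc k)"
      using step that by blast
  qed
  have mono: "G i \<subseteq> G j" if "i \<le> j" "enat j < N" for i j
    using that
  proof (induction j rule: dec_induct)
    case (step n)
    then show ?case
      using hullG[of n] ball_subset_hull[of "G n"] ball[rule_format, of n] less_Suc[of n] by blast
  qed simp
  have large: "2 ^ k * measure M A0 \<le> measure M (G k)" if "enat k < N" for k
    using that
  proof (induction k)
    case (Suc k)
    then show ?case
      using G2[of k] less_Suc[of k] by simp
  qed (simp add: G0)
  define dense where "dense k \<longleftrightarrow> enat k < N \<and> c * measure M (G k) < measure M (G k \<inter> H)" for k
  have dense_small: "c * measure M (G k) < \<theta> / (5 * K * \<beta>\<^sup>2) * measure M B" if "dense k" for k
  proof -
    have "measure M (G k \<inter> H) \<le> measure M H"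
      using that H ball ball_fmeasurable
      by (intro measure_mono_fmeasurable) (auto simp: dense_def)
    with that H show ?thesis
      by (auto simp: dense_def)
  qed
  have "dense 0"
    using A0 N by (simp add: dense_def G0 c_def zero_enat_def)
  moreover obtain b :: nat where b: "\<theta> / (5 * K * \<beta>\<^sup>2) * measure M B / (c * measure M A0) < b"
    using reals_Archimedean2 by blast
  moreover have "k < b" if "dense k" for k
  proof -
    have "c * (real k * measure M A0) \<le> c * measure M (G k)"
    proof (intro mult_left_mono)
      have "real k * measure M A0 \<le> 2 ^ k * measure M A0"
        using of_nat_less_two_power[of k, where ?'a = real] by (intro mult_right_mono) auto
      also have "\<dots> \<le> measure M (G k)"
        using large that by (simp add: dense_def)
      finally show "real k * measure M A0 \<le> measure M (G k)" .
    qed (use c in simp)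
    with dense_small[OF that] have "real k * (c * measure M A0) < \<theta> / (5 * K * \<beta>\<^sup>2) * measure M B"
      by (simp add: mult_ac)
    then have "real k < \<theta> / (5 * K * \<beta>\<^sup>2) * measure M B / (c * measure M A0)"
      using c ball_pos[OF A0(1)] by (subst pos_less_divide_eq) auto
    with b show ?thesis
      by linarith
  qed
  ultimately obtain k where k: "dense k" and last: "\<And>j. dense j \<Longrightarrow> j \<le> k"
    using ex_has_greatest_nat[of dense 0 "\<lambda>k. k" b] by metis
  have kN: "enat k < N" and k_dense: "c * measure M (G k) < measure M (G k \<inter> H)"
    using k by (auto simp: dense_def)
  \<comment> \<open>The factor between \<open>G k\<close> and \<open>B\<close> leaves room for one growth step.\<close>
  have "c * (\<beta> * measure M (G k)) = \<beta> * (c * measure M (G k))"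
    by simp
  also have "\<dots> \<le> \<beta> * (\<theta> / (5 * K * \<beta>\<^sup>2) * measure M B)"
    using dense_small[OF k] \<beta> by (intro mult_left_mono) auto
  also have "\<dots> = c * (4 / (5 * K) * measure M B)"
    using \<beta> K by (simp add: c_def field_simps power2_eq_square)
  also have "\<dots> < c * measure M B"
  proof -
    have "4 / (5 * K) < 1"
      using K by (simp add: divide_simps)
    then have "4 / (5 * K) * measure M B < 1 * measure M B"
      using ball_pos[OF B(1)] by (intro mult_strict_right_mono)
    then show ?thesis
      using c by (intro mult_strict_left_mono) auto
  qed
  finally have room: "\<beta> * measure M (G k) < measure M B"
    using c by simp
  \<comment> \<open>A member of the sequence smaller than \<open>B\<close> is not the last one, since some member contains \<open>B\<close>.\<close>
  have continues: "enat (Suc j) < N" if "enat j < N" "measure M (G j) < measure M B" for j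
  proof (rule ccontr)
    assume no: "\<not> ?thesis"
    obtain i where i: "enat i < N" "B \<subseteq> G i"
      using exhaust B by blast
    have "i \<le> j"
    proof (rule ccontr)
      assume "\<not> i \<le> j"
      then have "enat (Suc j) \<le> enat i"
        by simp
      with i no show False
        using order_le_less_trans by blast
    qed
    then have "B \<subseteq> G j"
      using i mono that by blast
    then have "measure M B \<le> measure M (G j)"
      using B that ball ball_fmeasurable by (intro measure_mono_fmeasurable) auto
    with that show False
      by simp
  qed
  have "1 * measure M (G k) \<le> \<beta> * measure M (G k)"
    using \<beta> by (intro mult_right_mono) auto
  then have k1: "enat (Suc k) < N"
    using continues[OF kN] room by simp
  have P_small: "measure M (G (Suc k)) < measure M B"
    using G\<beta>[OF k1] room by simp
  have k2: "enat (Suc (Suc k)) < N"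
    using continues[OF k1 P_small] .
  have PB: "G (Suc k) \<in> \<B>" "G (Suc (Suc k)) \<in> \<B>"
    using ball k1 k2 by auto
  show ?thesis
  proof
    show "G k \<in> \<B>" "G (Suc k) \<in> \<B>"
      using ball kN k1 by auto
    show "x \<in> G k" "x \<in> G (Suc k)"
      using mono[of 0] kN k1 A0 G0 by auto
    show "\<theta> / (4 * \<beta>) * measure M (G k) \<le> measure M (G k \<inter> H)"
      using k_dense by (simp add: c_def)
    show "hb (G k) \<subseteq> hb (G (Suc k))"
      using hullG[OF k1] ball_subset_hull[OF PB(1)] by blast
    have "measure M (hb (G (Suc k))) \<le> K * measure M (G (Suc k))"
      using hull_measure PB by blast
    also have "\<dots> \<le> K * (\<beta> * measure M (G k))"
      using G\<beta>[OF k1] K by (intro mult_left_mono) auto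
    finally show "measure M (hb (G (Suc k))) \<le> K * \<beta> * measure M (G k)"
      by (simp add: mult_ac)
    show "measure M (G (Suc k)) \<le> measure M B"
      using P_small by simp
    have "measure M (hb (G (Suc k)) \<inter> H) \<le> measure M (G (Suc (Suc k)) \<inter> H)"
      using hullG[OF k2] H PB hull_ball ball_fmeasurable
      by (intro measure_mono_fmeasurable) auto
    also have "\<dots> \<le> c * measure M (G (Suc (Suc k)))"
      using last[of "Suc (Suc k)"] k2 by (force simp: dense_def)
    also have "\<dots> \<le> c * (\<beta> * measure M (G (Suc k)))"
      using G\<beta>[OF k2] c by (intro mult_left_mono) auto
    also have "\<dots> = \<theta> / 4 * measure M (G (Suc k))"
      using \<beta> by (simp add: c_def)
    also have "\<dots> \<le> \<theta> / 4 * measure M (hb (G (Suc k)))"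
      using \<theta> PB hull_ball ball_fmeasurable ball_subset_hull
      by (intro mult_left_mono measure_mono_fmeasurable) auto
    finally show "measure M (hb (G (Suc k)) \<inter> H) \<le> \<theta> / 4 * measure M (hb (G (Suc k)))" .
  qed
qed

section \<open>Oscillation\<close>

text \<open>
  The set of small oscillation and \<open>U\<close> are too large to be essentially disjoint in \<open>Q\<close>, and
  one common point with \<open>\<bar>g\<bar> \<le> l\<close> controls \<open>g\<close> on the whole set of small oscillation.
\<close>

lemma exceptional_set_small:
  assumes Q: "Q \<in> \<B>" and osc: "OSC_ball M \<alpha> g Q < ereal t" and "0 \<le> \<alpha>"
    and U: "U \<in> sets M" "U \<subseteq> Q" "(1 - \<alpha>) * measure M Q \<le> measure M U"
    and g: "\<And>x. x \<in> U \<Longrightarrow> \<bar>g x\<bar> \<le> ereal l"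
  obtains T where "T \<in> fmeasurable M" "{x \<in> Q. \<bar>g x\<bar> > ereal (l + t)} \<subseteq> T"
    "measure M T \<le> (1 - \<alpha>) * measure M Q"
proof -
  obtain S where S: "S \<in> sets M" "S \<subseteq> Q" "ennreal \<alpha> * emeasure M Q < emeasure M S"
    and "OSC M g S < ereal t"
    using osc by (auto simp: OSC_ball_def INF_less_iff)
  then obtain c N where c: "c < ereal t" "N \<in> null_sets M"
    "\<And>x x'. x \<in> S - N \<Longrightarrow> x' \<in> S - N \<Longrightarrow> \<bar>g x - g x'\<bar> \<le> c"
    unfolding OSC_def Inf_less_iff by blast
  have Qf: "Q \<in> fmeasurable M"
    using Q ball_fmeasurable by blast
  have fm: "S \<in> fmeasurable M" "U \<in> fmeasurable M" "N \<in> fmeasurable M"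
    using S U c Qf by (auto intro: fmeasurableI2 fmeasurableI_null_sets)
  have S_large: "\<alpha> * measure M Q < measure M S"
    using S fm Qf \<open>0 \<le> \<alpha>\<close>
    by (simp add: emeasure_eq_measure2 ennreal_less_iff flip: ennreal_mult)
  have "\<exists>x0. x0 \<in> (S - N) \<inter> U"
  proof (rule ccontr)
    assume "\<not> ?thesis"
    then have "(S - N) \<inter> U = {}"
      by blast
    then have "measure M (S - N) + measure M U = measure M ((S - N) \<union> U)"
      using fm by (intro measure_Union[symmetric]) (auto simp: fmeasurableD2 fmeasurable.Diff)
    also have "\<dots> \<le> measure M Q"
      using fm Qf S U by (intro measure_mono_fmeasurable) auto
    finally show False
      using S_large U S c by (simp add: measure_Diff_null_set algebra_simps)
  qed
  then obtain x0 where x0: "x0 \<in> S - N" "x0 \<in> U"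
    by blast
  have bound: "\<bar>g x\<bar> \<le> ereal (l + t)" if "x \<in> S - N" for x
  proof -
    have "\<bar>g x - g x0\<bar> \<le> ereal t" "\<bar>g x0\<bar> \<le> ereal l"
      using c(1) c(3)[OF that x0(1)] g[OF x0(2)] by auto
    then show ?thesis
      by (cases "g x"; cases "g x0") auto
  qed
  show ?thesis
  proof
    show "(Q - S) \<union> N \<in> fmeasurable M"
      using fm Qf by auto
    show "{x \<in> Q. \<bar>g x\<bar> > ereal (l + t)} \<subseteq> (Q - S) \<union> N"
      using bound by (auto simp: not_le[symmetric])
    have "measure M ((Q - S) \<union> N) = measure M Q - measure M S"
      using fm Qf S c by (simp add: measure_Un_null_set measurable_measure_Diff fmeasurableD)
    then show "measure M ((Q - S) \<union> N) \<le> (1 - \<alpha>) * measure M Q"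
      using S_large by (simp add: algebra_simps)
  qed
qed

section \<open>The relative distribution inequality\<close>

text \<open>
  The strict bound \<open>t\<close> on the oscillations is what lets the infimum in the oscillation over a ball
  be replaced by an actual subset; it leaves the passage to the BMO norm itself as a limit in \<open>t\<close>.
\<close>

lemma exceedance_covered:
  assumes reg: "regularity_constant M \<B> hb \<theta>" and growth: "growth_constant M \<B> hb \<beta>"
    and \<epsilon>: "0 < \<epsilon>" "\<epsilon> < 1" and \<alpha>: "\<alpha> = 1 - \<epsilon> * \<theta> / (4 * \<beta>\<^sup>2 * K)" "0 \<le> \<alpha>"
    and osc: "\<And>Q. Q \<in> \<B> \<Longrightarrow> OSC_ball M \<alpha> g Q < ereal t" and "0 \<le> t"
    and B: "B \<in> \<B>"
    and H: "H \<in> sets M" "H \<subseteq> B" "{x \<in> B. \<bar>g x\<bar> > ereal l} \<subseteq> H"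
      "measure M H \<le> \<theta> / (5 * K * \<beta>\<^sup>2) * measure M B"
  obtains T where "T \<in> fmeasurable M" "{x \<in> B. \<bar>g x\<bar> > ereal (l + t)} \<subseteq> T"
    "measure M T \<le> \<epsilon> * measure M H"
proof -
  have \<theta>: "0 < \<theta>" "\<theta> < 1" and \<beta>: "2 < \<beta>" and K: "1 \<le> K"
    using reg growth K_ge_1 B by (auto simp: regularity_constant_def growth_constant_def)
  have Bf: "B \<in> fmeasurable M"
    using B ball_fmeasurable by blast
  have Hf: "H \<in> fmeasurable M"
    using H Bf by (blast intro: fmeasurableI2)
  define c where "c = \<theta> / (4 * \<beta>)"
  have c: "0 < c" "2 * c \<le> 1"
    using \<theta> \<beta> by (auto simp: c_def divide_simps)
  have \<alpha>_quarter: "1 - \<alpha> \<le> \<theta> / 4"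
  proof -
    have "1 \<le> \<beta>\<^sup>2 * K"
      using \<beta> K by (intro mult_ge1_I) auto
    then have "\<epsilon> / (\<beta>\<^sup>2 * K) \<le> 1"
      using \<epsilon> by simp
    then have "\<epsilon> / (\<beta>\<^sup>2 * K) * (\<theta> / 4) \<le> 1 * (\<theta> / 4)"
      using \<theta> by (intro mult_right_mono) auto
    then show ?thesis
      unfolding \<alpha>(1) by (simp add: mult_ac)
  qed
  \<comment> \<open>No growth sequence can be started with high density at the points of \<open>D\<close>.\<close>
  define D where "D = {x \<in> H. \<forall>A\<in>\<B>. x \<in> A \<longrightarrow> measure M (A \<inter> H) \<le> c * measure M A}"
  obtain N where N: "N \<in> null_sets M" "D \<subseteq> N"
  proof (rule sparse_points_null[OF Hf])
    fix A assume A: "A \<in> \<B>" "A \<inter> D \<noteq> {}"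
    then have "2 * measure M (A \<inter> H) \<le> (2 * c) * measure M A"
      by (auto simp: D_def)
    also have "\<dots> \<le> 1 * measure M A"
      using c by (intro mult_right_mono) auto
    finally show "2 * measure M (A \<inter> H) \<le> measure M A"
      by simp
  qed (auto simp: D_def)
  define stop where "stop A P \<longleftrightarrow> A \<in> \<B> \<and> P \<in> \<B> \<and> P \<inter> B \<noteq> {} \<and>
    c * measure M A \<le> measure M (A \<inter> H) \<and> hb A \<subseteq> hb P \<and>
    measure M (hb P) \<le> K * \<beta> * measure M A \<and> measure M P \<le> measure M B \<and>
    measure M (hb P \<inter> H) \<le> \<theta> / 4 * measure M (hb P)" for A P
  have stopping: "\<exists>A P. x \<in> A \<and> stop A P" if x: "x \<in> H - N" for x
  proof -
    have "x \<in> H" "x \<notin> D"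
      using x N by auto
    then obtain A0 where A0: "A0 \<in> \<B>" "x \<in> A0" "c * measure M A0 < measure M (A0 \<inter> H)"
      unfolding D_def mem_Collect_eq by (meson not_le)
    obtain A P where "A \<in> \<B>" "P \<in> \<B>" "x \<in> A" "x \<in> P"
      "\<theta> / (4 * \<beta>) * measure M A \<le> measure M (A \<inter> H)"
      "hb A \<subseteq> hb P" "measure M (hb P) \<le> K * \<beta> * measure M A" "measure M P \<le> measure M B"
      "measure M (hb P \<inter> H) \<le> \<theta> / 4 * measure M (hb P)"
      using growth_stopping[OF growth \<theta>(1) B _ Hf H(4) A0(1,2)] x H A0(3)
      unfolding c_def by blast
    with x H show ?thesis
      unfolding stop_def c_def by blast
  qed
  define \<A> where "\<A> = {A. \<exists>P. stop A P}"
  have AB: "\<A> \<subseteq> \<B>"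
    by (auto simp: \<A>_def stop_def)
  have dense: "measure M A \<le> (1 / c) * measure M (A \<inter> H)" if "A \<in> \<A>" for A
    using that c by (auto simp: \<A>_def stop_def field_simps)
  obtain \<V> where V: "\<V> \<subseteq> \<A>" "countable \<V>" "disjoint \<V>" "\<Union>\<A> \<subseteq> (\<Union>A\<in>\<V>. hb A)"
    using vitali_selection[OF AB Hf dense] .
  have "\<exists>T. T \<in> fmeasurable M \<and> {x \<in> hb A. \<bar>g x\<bar> > ereal (l + t)} \<subseteq> T \<and>
      measure M T \<le> \<epsilon> * measure M (A \<inter> H)" if "A \<in> \<V>" for A
  proof -
    from that V obtain P where P: "stop A P"
      by (auto simp: \<A>_def)
    define Q where "Q = hb P"
    have QB: "Q \<in> \<B>" "Q \<in> fmeasurable M"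
      using P hull_ball ball_fmeasurable by (auto simp: stop_def Q_def)
    have "ennreal \<theta> * emeasure M Q \<le> emeasure M (Q \<inter> B)"
    proof -
      have "emeasure M P \<le> emeasure M B" "B \<inter> P \<noteq> {}" "P \<in> \<B>"
        using P B by (auto simp: stop_def ball_emeasure)
      with reg B show ?thesis
        unfolding regularity_constant_def Q_def by blast
    qed
    then have \<theta>Q: "\<theta> * measure M Q \<le> measure M (Q \<inter> B)"
      using \<theta> QB Bf by (simp add: emeasure_eq_measure2 fmeasurable_Int_fmeasurable fmeasurableD
          flip: ennreal_mult)
    have "measure M ((Q \<inter> B) - (Q \<inter> H)) = measure M (Q \<inter> B) - measure M (Q \<inter> H)"
      using H QB Bf
      by (intro measurable_measure_Diff) (auto intro: fmeasurable_Int_fmeasurable)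
    then have "3 / 4 * (\<theta> * measure M Q) \<le> measure M ((Q \<inter> B) - (Q \<inter> H))"
      using \<theta>Q P by (simp add: stop_def Q_def)
    moreover have "(1 - \<alpha>) * measure M Q \<le> \<theta> / 4 * measure M Q"
      using \<alpha>_quarter by (intro mult_right_mono) auto
    moreover have "0 \<le> \<theta> * measure M Q"
      using \<theta> by simp
    ultimately have U: "(1 - \<alpha>) * measure M Q \<le> measure M ((Q \<inter> B) - (Q \<inter> H))"
      by linarith
    obtain T where T: "T \<in> fmeasurable M" "{x \<in> Q. \<bar>g x\<bar> > ereal (l + t)} \<subseteq> T"
      "measure M T \<le> (1 - \<alpha>) * measure M Q"
    proof (rule exceptional_set_small[OF QB(1) osc[OF QB(1)] \<alpha>(2) _ _ U])
      show "\<bar>g x\<bar> \<le> ereal l" if "x \<in> Q \<inter> B - Q \<inter> H" for x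
        using that H(3) by (auto simp: not_le[symmetric])
    qed (use QB Bf H in auto)
    have "(1 - \<alpha>) * measure M Q \<le> (1 - \<alpha>) * (K * \<beta> * measure M A)"
      using P \<alpha> \<epsilon> \<theta> K by (intro mult_left_mono) (auto simp: stop_def Q_def)
    also have "\<dots> \<le> (1 - \<alpha>) * (K * \<beta> * ((1 / c) * measure M (A \<inter> H)))"
      using dense that V \<alpha> \<epsilon> \<theta> K \<beta> by (intro mult_left_mono) auto
    also have "\<dots> = \<epsilon> * measure M (A \<inter> H)"
      unfolding \<alpha>(1) c_def using \<theta> K \<beta> by (simp add: field_simps power2_eq_square)
    finally have "measure M T \<le> \<epsilon> * measure M (A \<inter> H)"
      using T(3) by simp
    moreover have "hb A \<subseteq> Q"
      using P by (simp add: stop_def Q_def)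
    ultimately show ?thesis
      using T(1,2) by blast
  qed
  then obtain T where T: "\<And>A. A \<in> \<V> \<Longrightarrow> T A \<in> fmeasurable M"
    "\<And>A. A \<in> \<V> \<Longrightarrow> {x \<in> hb A. \<bar>g x\<bar> > ereal (l + t)} \<subseteq> T A"
    "\<And>A. A \<in> \<V> \<Longrightarrow> measure M (T A) \<le> \<epsilon> * measure M (A \<inter> H)"
    by metis
  have UT: "(\<Union>A\<in>\<V>. T A) \<in> fmeasurable M" "measure M (\<Union>A\<in>\<V>. T A) \<le> \<epsilon> * measure M H"
    using measure_UN_le_disjoint[OF V(2) _ V(3) Hf, of \<epsilon> T] V(1) AB ball_fmeasurable T \<epsilon>
    by auto
  show ?thesis
  proof
    show "(\<Union>A\<in>\<V>. T A) \<union> N \<in> fmeasurable M"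
      using UT N by (auto intro: fmeasurableI_null_sets)
    show "measure M ((\<Union>A\<in>\<V>. T A) \<union> N) \<le> \<epsilon> * measure M H"
      using UT N by (simp add: measure_Un_null_set fmeasurableD)
    show "{x \<in> B. \<bar>g x\<bar> > ereal (l + t)} \<subseteq> (\<Union>A\<in>\<V>. T A) \<union> N"
    proof
      fix x assume x: "x \<in> {x \<in> B. \<bar>g x\<bar> > ereal (l + t)}"
      have "ereal l \<le> ereal (l + t)" "ereal (l + t) < \<bar>g x\<bar>"
        using \<open>0 \<le> t\<close> x by simp_all
      then have "ereal l < \<bar>g x\<bar>"
        by (rule order_le_less_trans)
      with x H(3) have xH: "x \<in> H"
        by blast
      show "x \<in> (\<Union>A\<in>\<V>. T A) \<union> N"
      proof (cases "x \<in> N")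
        case False
        with xH stopping have "x \<in> \<Union>\<A>"
          unfolding \<A>_def by blast
        with V(4) obtain A where "A \<in> \<V>" "x \<in> hb A"
          by blast
        with x T(2) show ?thesis
          by blast
      qed simp
    qed
  qed
qed

end

theorem proposition5p1:
  fixes M :: "'a measure" and \<B> :: "'a set set" and hb :: "'a set \<Rightarrow> 'a set"
    and K \<theta> \<beta> \<epsilon> \<alpha> l :: real and g :: "'a \<Rightarrow> ereal" and B :: "'a set"
  assumes "ball_basis M \<B> hb K"
    and "doubling M \<B> hb"
    and "regularity_constant M \<B> hb \<theta>"
    and "growth_constant M \<B> hb \<beta>"
    and "0 < \<epsilon>" and "\<epsilon> < 1"
    and "\<alpha> = 1 - \<epsilon> * \<theta> / (4 * \<beta>\<^sup>2 * K)" and "\<alpha> > 1/2"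
    and "g \<in> BMO M \<B> \<alpha>"
    and "B \<in> \<B>" and "l > 0"
    and "outer_measure_of M {x \<in> B. \<bar>g x\<bar> > ereal l} \<le> ennreal (\<theta> / (5 * K * \<beta>\<^sup>2)) * emeasure M B"
  shows "outer_measure_of M {x \<in> B. \<bar>g x\<bar> > ereal l + BMO_norm M \<B> \<alpha> g}
           \<le> ennreal \<epsilon> * outer_measure_of M {x \<in> B. \<bar>g x\<bar> > ereal l}"
proof -
  interpret ball_basis_space M \<B> hb K
    using assms by unfold_locales
  define E where "E = {x \<in> B. \<bar>g x\<bar> > ereal l}"
  have Bf: "B \<in> fmeasurable M" and BM: "B \<subseteq> space M"
    using assms ball_fmeasurable sets.sets_into_space fmeasurableD by blast+
  have "E \<subseteq> space M"
    using BM by (auto simp: E_def)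
  then obtain H0 where H0: "H0 \<in> sets M" "E \<subseteq> H0" "outer_measure_of M E = emeasure M H0"
    by (auto dest: outer_measure_of_attain)
  define H where "H = H0 \<inter> B"
  have H: "H \<in> sets M" "H \<subseteq> B" "E \<subseteq> H"
    using H0 Bf by (auto simp: H_def E_def)
  have Hf: "H \<in> fmeasurable M"
    using H Bf by (blast intro: fmeasurableI2)
  have HE: "emeasure M H = outer_measure_of M E"
  proof (rule antisym)
    show "emeasure M H \<le> outer_measure_of M E"
      using H0 by (auto simp: H_def intro: emeasure_mono)
    show "outer_measure_of M E \<le> emeasure M H"
      using outer_measure_of_mono[OF H(3), of M] H by simp
  qed
  have pos: "0 \<le> \<theta> / (5 * K * \<beta>\<^sup>2)"
    using assms(3) K_pos by (simp add: regularity_constant_def)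
  have "ennreal (measure M H) \<le> ennreal (\<theta> / (5 * K * \<beta>\<^sup>2)) * ennreal (measure M B)"
    using assms(12) HE Hf Bf by (simp add: E_def emeasure_eq_measure2)
  also have "\<dots> = ennreal (\<theta> / (5 * K * \<beta>\<^sup>2) * measure M B)"
    using pos by (intro ennreal_mult[symmetric]) auto
  finally have H_small: "measure M H \<le> \<theta> / (5 * K * \<beta>\<^sup>2) * measure M B"
    by (rule ennreal_le_iff[THEN iffD1, rotated]) (intro mult_nonneg_nonneg pos measure_nonneg)
  have osc_le: "OSC_ball M \<alpha> g Q \<le> BMO_norm M \<B> \<alpha> g" if "Q \<in> \<B>" for Q
    using that by (auto simp: BMO_norm_def intro: SUP_upper)
  have "0 \<le> OSC_ball M \<alpha> g B"
    by (auto simp: OSC_ball_def OSC_def intro!: INF_greatest Inf_greatest)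
  then have "0 \<le> BMO_norm M \<B> \<alpha> g"
    using osc_le assms(10) order_trans by blast
  moreover have "BMO_norm M \<B> \<alpha> g < \<infinity>"
    using assms(9) by (simp add: BMO_def)
  ultimately obtain n where n: "BMO_norm M \<B> \<alpha> g = ereal n" "0 \<le> n"
    by (cases "BMO_norm M \<B> \<alpha> g") auto
  define F where "F i = {x \<in> B. \<bar>g x\<bar> > ereal (l + (n + 1 / real (Suc i)))}" for i
  have F_le: "outer_measure_of M (F i) \<le> ennreal \<epsilon> * outer_measure_of M E" for i
  proof -
    have "OSC_ball M \<alpha> g Q < ereal (n + 1 / real (Suc i))" if "Q \<in> \<B>" for Q
      using osc_le[OF that] n by (simp add: order_le_less_trans)
    moreover have "0 \<le> \<alpha>" "0 \<le> n + 1 / real (Suc i)"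
      using assms(8) n by auto
    ultimately obtain T where T: "T \<in> fmeasurable M" "F i \<subseteq> T"
      "measure M T \<le> \<epsilon> * measure M H"
      using exceedance_covered[OF assms(3-7), of g "n + 1 / real (Suc i)" B H l] H H_small assms(10)
      unfolding F_def E_def by blast
    have "outer_measure_of M (F i) \<le> outer_measure_of M T"
      using T by (intro outer_measure_of_mono)
    also have "\<dots> = ennreal (measure M T)"
      using T by (simp add: emeasure_eq_measure2 fmeasurableD)
    also have "\<dots> \<le> ennreal (\<epsilon> * measure M H)"
      using T by (intro ennreal_leI)
    also have "\<dots> = ennreal \<epsilon> * outer_measure_of M E"
      using assms(5) HE Hf by (simp add: ennreal_mult emeasure_eq_measure2)
    finally show ?thesis .
  qed
  have F_sub: "F i \<subseteq> space M" for i
    using BM by (auto simp: F_def)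
  have "incseq F"
  proof (rule incseq_SucI)
    fix i
    have "ereal (l + (n + 1 / real (Suc (Suc i)))) \<le> ereal (l + (n + 1 / real (Suc i)))"
      by (simp add: frac_le)
    then show "F i \<subseteq> F (Suc i)"
      unfolding F_def by (blast intro: order_le_less_trans)
  qed
  have "{x \<in> B. \<bar>g x\<bar> > ereal l + BMO_norm M \<B> \<alpha> g} \<subseteq> (\<Union>i. F i)"
  proof
    fix x assume "x \<in> {x \<in> B. \<bar>g x\<bar> > ereal l + BMO_norm M \<B> \<alpha> g}"
    then have x: "x \<in> B" "\<bar>g x\<bar> > ereal (l + n)"
      using n by auto
    obtain i where "ereal (l + n + 1 / real (Suc i)) < \<bar>g x\<bar>"
    proof (cases "\<bar>g x\<bar>")
      case (real r)
      with x have "0 < r - (l + n)"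
        by simp
      then obtain i where "inverse (real (Suc i)) < r - (l + n)"
        using reals_Archimedean by blast
      with real show ?thesis
        by (intro that[of i]) (simp add: inverse_eq_divide)
    qed (use that x in auto)
    with x show "x \<in> (\<Union>i. F i)"
      by (auto simp: F_def add.assoc)
  qed
  then have "outer_measure_of M {x \<in> B. \<bar>g x\<bar> > ereal l + BMO_norm M \<B> \<alpha> g}
      \<le> outer_measure_of M (\<Union>i. F i)"
    by (rule outer_measure_of_mono)
  also have "\<dots> = (SUP i. outer_measure_of M (F i))"
    by (rule SUP_outer_measure_of_incseq[symmetric, OF F_sub \<open>incseq F\<close>])
  also have "\<dots> \<le> ennreal \<epsilon> * outer_measure_of M E"
    using F_le by (rule SUP_least)
  finally show ?thesis
    by (simp add: E_def)
qed

end
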